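(* Let $k\ge 1$, let $\lambda_1,\dots,\lambda_k>0$ be pairwise distinct real numbers, let $h_1,\dots,h_k\in\mathbb{C}$, and let $w_1,\dots,w_k\in\mathbb{C}$ with $w_i\neq 0$ for all $i$. Let $$\hat H(s)=\frac{\sum_{i=1}^k\left(\frac{h_iw_i}{s-j\lambda_i}+\frac{(h_iw_i)^*}{s+j\lambda_i}\right)}{\sum_{i=1}^k\left(\frac{w_i}{s-j\lambda_i}+\frac{w_i^*}{s+j\lambda_i}\right)}=\frac{N(s)}{D(s)},$$ where $N(s)$ and $D(s)$ denote the numerator and denominator sums. Let $(\mathcal{A},\mathcal{B},\mathcal{C})$ be a real state-space realization of $D(s)$ of size $2k$, i.e. $\mathcal{A}\in\mathbb{R}^{2k\times 2k}$, $\mathcal{B}\in\mathbb{R}^{2k\times 1}$, $\mathcal{C}\in\mathbb{R}^{1\times 2k}$ and $D(s)=\mathcal{C}(s I_{2k}-\mathcal{A})^{-1}\mathcal{B}$. Assume that $\hat H(s)$ has $2k-1$ poles. Then $\hat H(s)$ is asymptotically stable if and only if one of the following two conditions holds: 1. $\mathcal{C}\mathcal{B}>0$ and there exists $g\in\mathbb{R}$ such that $$G^+(s)=\frac{D(s)}{1+gD(s)}=\mathcal{C}(sI_{2k}-\mathcal{A}+g\mathcal{B}\mathcal{C})^{-1}\mathcal{B}$$ is strictly positive real; or 2. $\mathcal{C}\mathcal{B}<0$ and there exists $g\in\mathbb{R}$ such that $$G^-(s)=\frac{-D(s)}{1-gD(s)}=-\mathcal{C}(sI_{2k}-\mathcal{A}-g\mathcal{B}\mathcal{C})^{-1}\mathcal{B}$$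 is strictly positive real.
   Context: Here $j=\sqrt{-1}$, $z^*$ is the complex conjugate of $z$, and $I_{2k}$ is the identity matrix of size $2k$. Poles of a rational function are those remaining after cancellation of common factors of numerator and denominator, and are counted with multiplicity; "poles of $\hat H$" means finite poles. A rational function is asymptotically stable if all its poles have strictly negative real part. A rational function $F(s)$ is positive real (PR) if: (i) $F(s)$ has no poles in $\mathrm{Re}(s)>0$; (ii) $F(s)$ is real for all positive real $s$; (iii) $\mathrm{Re}(F(s))\ge 0$ for all $s$ with $\mathrm{Re}(s)>0$. A rational function $F(s)$ that is not identically zero is strictly positive real (SPR) if $F(s-\tau)$ is PR for some $\tau>0$. *)

theory Defs
  imports
    Complex_Main
    "HOL-Computational_Algebra.Computational_Algebra"
    "HOL-Computational_Algebra.Field_as_Ring"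
    "Jordan_Normal_Form.Gauss_Jordan_Elimination"
begin

text \<open>
  A rational function of a complex variable is an element of the field of fractions of
  \<^typ>\<open>complex poly\<close>. \<^const>\<open>quot_of_fract\<close> returns the coprime numerator and (monic)
  denominator that remain after all common factors have been cancelled.
\<close>

type_synonym ratfun = "complex poly fract"

definition rf_const :: "complex \<Rightarrow> ratfun" where
  "rf_const c = to_fract [:c:]"

definition rf_var :: ratfun where
  "rf_var = to_fract [:0, 1:]"

definition rf_num :: "ratfun \<Rightarrow> complex poly" where
  "rf_num F = fst (quot_of_fract F)"

definition rf_den :: "ratfun \<Rightarrow> complex poly" where
  "rf_den F = snd (quot_of_fract F)"

text \<open>The value at a pole is the junk value 0; below, values are only used at points
  where poles are excluded.\<close>

definition rf_eval :: "ratfun \<Rightarrow> complex \<Rightarrow> complex" where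
  "rf_eval F s = poly (rf_num F) s / poly (rf_den F) s"

text \<open>The finite poles, as a multiset, hence counted with multiplicity.\<close>

definition rf_poles :: "ratfun \<Rightarrow> complex multiset" where
  "rf_poles F = proots (rf_den F)"

text \<open>\<open>rf_shift \<tau> F\<close> is \<open>F(s - \<tau>)\<close>.\<close>

definition rf_shift :: "real \<Rightarrow> ratfun \<Rightarrow> ratfun" where
  "rf_shift \<tau> F =
     to_fract (pcompose (rf_num F) [:- complex_of_real \<tau>, 1:]) /
     to_fract (pcompose (rf_den F) [:- complex_of_real \<tau>, 1:])"

definition asymptotically_stable :: "ratfun \<Rightarrow> bool" where
  "asymptotically_stable F \<longleftrightarrow> (\<forall>p \<in># rf_poles F. Re p < 0)"

definition positive_real :: "ratfun \<Rightarrow> bool" where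
  "positive_real F \<longleftrightarrow>
     (\<forall>p \<in># rf_poles F. \<not> Re p > 0) \<and>
     (\<forall>x::real. x > 0 \<longrightarrow> rf_eval F (complex_of_real x) \<in> \<real>) \<and>
     (\<forall>s. Re s > 0 \<longrightarrow> Re (rf_eval F s) \<ge> 0)"

definition strictly_positive_real :: "ratfun \<Rightarrow> bool" where
  "strictly_positive_real F \<longleftrightarrow> F \<noteq> 0 \<and> (\<exists>\<tau>>0. positive_real (rf_shift \<tau> F))"

text \<open>A real matrix viewed as a matrix of constant rational functions.\<close>

definition rf_mat :: "real mat \<Rightarrow> ratfun mat" where
  "rf_mat M = map_mat (\<lambda>x. rf_const (complex_of_real x)) M"

text \<open>
  \<open>C (s I - A)\<^sup>-\<^sup>1 B\<close>, computed over the field of rational functions and read off as the single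
  entry of a 1-by-1 matrix. The option returned by \<^const>\<open>mat_inverse\<close> is never \<open>None\<close>
  here for square \<open>A\<close>: the determinant of \<open>s I - A\<close> is the characteristic polynomial of
  \<open>A\<close>, which is a nonzero rational function.
\<close>

definition transfer_function :: "real mat \<Rightarrow> real mat \<Rightarrow> real mat \<Rightarrow> ratfun" where
  "transfer_function A B C =
     (rf_mat C * the (mat_inverse (rf_var \<cdot>\<^sub>m 1\<^sub>m (dim_row A) - rf_mat A)) * rf_mat B) $$ (0, 0)"

end

theory Submission
  imports Defs "HOL-Complex_Analysis.Conformal_Mappings" "Jordan_Normal_Form.Determinant"
begin

hide_const (open) Module.smult

text \<open>
  Over the common denominator \<open>Q = \<Prod>\<^sub>i (s\<^sup>2 + \<lambda>\<^sub>i\<^sup>2)\<close> the two sums are \<open>N = R/Q\<close> and \<open>D = P/Q\<close>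
  with \<open>P\<close> and \<open>Q\<close> real, \<open>Q\<close> monic of degree \<open>2k\<close> and \<open>degree P \<le> 2k - 1\<close>; since the weights
  \<open>w\<^sub>i\<close> do not vanish and the \<open>\<lambda>\<^sub>i\<close> are distinct, \<open>P\<close> and \<open>Q\<close> have no common root. Hence
  \<open>H = R/P\<close>, and the assumption that \<open>H\<close> has \<open>2k - 1\<close> poles forces \<open>degree P = 2k - 1\<close> with no
  cancellation: \<open>H\<close> is stable if and only if all roots of \<open>P\<close> have negative real part. Moreover the
  coefficient of \<open>P\<close> at \<open>2k - 1\<close> is the first Markov parameter \<open>CB\<close>
  (\<open>coeff_transfer_function\<close>), which is therefore nonzero. Replacing \<open>D\<close> by \<open>- D\<close> reduces the case
  \<open>CB < 0\<close> to the case \<open>CB > 0\<close>.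

  It remains to see that, for \<open>CB > 0\<close>, \<open>P\<close> is Hurwitz if and only if \<open>F = P/(Q + gP)\<close> is strictly
  positive real for some real \<open>g\<close> (\<open>hurwitz_iff_strictly_positive_real\<close>). If \<open>F\<close> is strictly positive
  real, then the open mapping theorem forbids zeros of \<open>F\<close> in the closed right half-plane, and
  every root of \<open>P\<close> is a zero of \<open>F\<close>. Conversely, division with remainder gives
  \<open>1/F = Q/P + g = bs + c + g + T/P\<close> with \<open>b = 1/CB > 0\<close> and \<open>T/P\<close> strictly proper. If \<open>P\<close> is Hurwitz
  then \<open>T/P\<close> is bounded on a half-plane \<open>Re s \<ge> - \<tau>\<close> with \<open>\<tau> > 0\<close>, so a large \<open>g\<close> makes the real part
  of \<open>1/F\<close>, hence that of \<open>F\<close>, positive there.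

  The state space formulas rest on one degree comparison (\<open>resolvent_numerator_degree\<close>): a rational
  vector \<open>x\<close> with \<open>s x = b + A x\<close> is strictly proper, and is zero if \<open>b = 0\<close>. This yields the
  invertibility of \<open>sI - A\<close>, the feedback formula \<open>C (sI - A + gBC)\<^sup>-\<^sup>1 B = D/(1 + gD)\<close>, and the
  leading coefficient \<open>CB\<close>.
\<close>

section \<open>Rational functions as fractions of polynomials\<close>

lemma rf_num_den: "to_fract (rf_num F) / to_fract (rf_den F) = F"
  unfolding rf_num_def rf_den_def by (metis Fract_conv_to_fract Fract_quot_of_fract)

lemma rf_den_nonzero [simp]: "rf_den F \<noteq> 0"
  by (simp add: rf_den_def)

lemma rf_num_eq_0_iff [simp]: "rf_num F = 0 \<longleftrightarrow> F = 0"
  by (simp add: rf_num_def)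

lemma to_fract_divide_eq_iff:
  fixes p q p' q' :: "complex poly"
  assumes "q \<noteq> 0" "q' \<noteq> 0"
  shows "to_fract p / to_fract q = to_fract p' / to_fract q' \<longleftrightarrow> p * q' = p' * q"
  using assms by (simp add: frac_eq_eq flip: to_fract_mult)

lemma rf_num_mult_eq:
  assumes "q \<noteq> 0" "F = to_fract p / to_fract q"
  shows "rf_num F * q = p * rf_den F"
  using assms to_fract_divide_eq_iff[of "rf_den F" q "rf_num F" p] rf_num_den[of F] by simp

lemma rf_den_dvd:
  assumes "q \<noteq> 0" "F = to_fract p / to_fract q"
  shows "rf_den F dvd q"
proof -
  have "rf_den F dvd rf_num F * q"
    using rf_num_mult_eq[OF assms] by simp
  moreover have "coprime (rf_den F) (rf_num F)"
    unfolding rf_den_def rf_num_def by (simp add: coprime_commute coprime_quot_of_fract)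
  ultimately show ?thesis
    by (simp add: coprime_dvd_mult_right_iff)
qed

text \<open>
  A representation need not be in lowest terms: wherever its denominator does not vanish, neither
  does the reduced denominator, and the value can be read off the representation.
\<close>

lemma poly_rf_den_nonzero:
  assumes "poly q s \<noteq> 0" "F = to_fract p / to_fract q"
  shows "poly (rf_den F) s \<noteq> 0"
proof -
  have "q \<noteq> 0" using assms(1) by auto
  then have "rf_den F dvd q" using rf_den_dvd assms(2) by blast
  then show ?thesis using assms(1) by (auto elim!: dvdE)
qed

lemma rf_eval_fraction:
  assumes "poly q s \<noteq> 0" "F = to_fract p / to_fract q"
  shows "rf_eval F s = poly p s / poly q s"
proof -
  have "q \<noteq> 0" using assms(1) by auto
  then have "poly (rf_num F) s * poly q s = poly p s * poly (rf_den F) s"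
    using rf_num_mult_eq[OF _ assms(2)] by (metis poly_mult)
  then show ?thesis
    using assms poly_rf_den_nonzero[OF assms] by (simp add: rf_eval_def frac_eq_eq)
qed

lemma in_rf_poles_iff: "s \<in># rf_poles F \<longleftrightarrow> poly (rf_den F) s = 0"
  by (simp add: rf_poles_def)

lemma pcompose_shift_eq_0_iff [simp]: "pcompose p [:c, 1:] = 0 \<longleftrightarrow> p = (0 :: complex poly)"
  using pcompose_eq_0_iff[of "[:c, 1:]" p] by simp

lemma rf_shift_fraction:
  assumes "q \<noteq> 0" "F = to_fract p / to_fract q"
  shows "rf_shift \<tau> F = to_fract (pcompose p [:- complex_of_real \<tau>, 1:]) /
                        to_fract (pcompose q [:- complex_of_real \<tau>, 1:])"
  unfolding rf_shift_def using assms rf_num_mult_eq[OF assms]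
  by (subst to_fract_divide_eq_iff) (auto simp flip: pcompose_mult)

lemma rf_const_simps [simp]: "rf_const 0 = 0" "rf_const 1 = 1"
  "rf_const (x + y) = rf_const x + rf_const y" "rf_const (x - y) = rf_const x - rf_const y"
  "rf_const (- x) = - rf_const x"
  "rf_const (x * y) = rf_const x * rf_const y"
proof -
  show "rf_const 1 = 1" by (simp add: rf_const_def flip: one_pCons)
  show "rf_const (x + y) = rf_const x + rf_const y"
    unfolding rf_const_def to_fract_add[symmetric] by simp
  show "rf_const (x - y) = rf_const x - rf_const y"
    unfolding rf_const_def to_fract_diff[symmetric] by simp
  show "rf_const (- x) = - rf_const x"
    unfolding rf_const_def to_fract_uminus[symmetric] by simp
  show "rf_const (x * y) = rf_const x * rf_const y"
    unfolding rf_const_def to_fract_mult[symmetric] by simp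
qed (simp add: rf_const_def)

lemma to_fract_smult: "to_fract (smult c p) = rf_const c * to_fract p"
  unfolding rf_const_def to_fract_mult[symmetric] by simp

lemma common_denominator:
  fixes x :: "nat \<Rightarrow> ratfun"
  shows "\<exists>p q. q \<noteq> 0 \<and> (\<forall>i<n. x i = to_fract (p i) / to_fract q)"
proof -
  define q where "q = (\<Prod>i<n. rf_den (x i))"
  define p where "p = (\<lambda>i. rf_num (x i) * (\<Prod>l\<in>{..<n}-{i}. rf_den (x l)))"
  have q: "q \<noteq> 0" by (simp add: q_def)
  have "x i = to_fract (p i) / to_fract q" if i: "i < n" for i
  proof -
    have q_eq: "q = rf_den (x i) * (\<Prod>l\<in>{..<n}-{i}. rf_den (x l))"
      unfolding q_def using i by (intro prod.remove) auto
    have "to_fract (rf_num (x i)) / to_fract (rf_den (x i)) = to_fract (p i) / to_fract q"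
      using q by (subst to_fract_divide_eq_iff) (auto simp: p_def q_eq)
    then show ?thesis by (simp add: rf_num_den)
  qed
  with q show ?thesis by blast
qed

section \<open>Zeros and poles of strictly positive real functions\<close>

text \<open>
  A nonconstant holomorphic function on the open right half-plane is open, so at a zero it would
  also take values with negative real part.
\<close>

lemma positive_real_imp_num_nonzero:
  assumes pr: "positive_real F" and F: "F \<noteq> 0" and s: "Re s > 0"
  shows "poly (rf_num F) s \<noteq> 0"
proof
  assume zero: "poly (rf_num F) s = 0"
  define S where "S = {z. Re z > 0}"
  define f where "f = (\<lambda>z. poly (rf_num F) z / poly (rf_den F) z)"
  have den: "poly (rf_den F) z \<noteq> 0" if "z \<in> S" for z
    using pr that by (auto simp: positive_real_def in_rf_poles_iff S_def)
  have nonneg: "Re (f z) \<ge> 0" if "z \<in> S" for z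
    using pr that by (auto simp: positive_real_def S_def f_def rf_eval_def)
  have S: "open S" "connected S"
    unfolding S_def using open_halfspace_Re_gt[of 0] 
    by (auto intro!: convex_connected convex_halfspace_Re_gt)
  have sS: "s \<in> S" using s by (simp add: S_def)
  have holo: "f holomorphic_on S"
    unfolding f_def using den by (intro holomorphic_intros) auto
  have "\<not> f constant_on S"
  proof
    assume "f constant_on S"
    then obtain c where c: "\<And>z. z \<in> S \<Longrightarrow> f z = c" by (auto simp: constant_on_def)
    have "c = 0" using c[OF sS] zero by (simp add: f_def)
    then have "S \<subseteq> {z. poly (rf_num F) z = 0}" using c den by (auto simp: f_def)
    then have "finite S" using F poly_roots_finite[of "rf_num F"] by (auto intro: finite_subset)
    then show False using S sS by (metis empty_iff finite_imp_not_open)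
  qed
  then have "open (f ` S)" using open_mapping_thm[OF holo S S(1)] by auto
  moreover have "0 \<in> f ` S" using sS zero by (force simp: f_def image_iff)
  ultimately obtain e where e: "e > 0" "cball 0 e \<subseteq> f ` S"
    by (meson open_contains_cball)
  \<comment> \<open>An open set around 0 contains a negative real number.\<close>
  then have "- complex_of_real e \<in> f ` S" by (auto intro!: subsetD[OF e(2)])
  then obtain z where "z \<in> S" "f z = - complex_of_real e" by auto
  then show False using nonneg[of z] e(1) by simp
qed

text \<open>
  The shift by \<open>\<tau> > 0\<close> moves the closed right half-plane into the open one, where the previous
  lemma applies.
\<close>

lemma strictly_positive_real_imp_num_nonzero:
  assumes spr: "strictly_positive_real (to_fract p / to_fract q)"
    and q: "poly q s \<noteq> 0" and s: "Re s \<ge> 0"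
  shows "poly p s \<noteq> 0"
proof
  assume p: "poly p s = 0"
  let ?F = "to_fract p / to_fract q"
  obtain \<tau> where \<tau>: "\<tau> > 0" "positive_real (rf_shift \<tau> ?F)" and F: "?F \<noteq> 0"
    using spr by (auto simp: strictly_positive_real_def)
  let ?p = "pcompose p [:- complex_of_real \<tau>, 1:]"
  let ?q = "pcompose q [:- complex_of_real \<tau>, 1:]"
  let ?G = "rf_shift \<tau> ?F" and ?s = "s + complex_of_real \<tau>"
  have q0: "q \<noteq> 0" using q by auto
  have G: "?G = to_fract ?p / to_fract ?q" by (rule rf_shift_fraction[OF q0 refl])
  have nz: "?q \<noteq> 0" "?G \<noteq> 0" using q0 F by (auto simp: G)
  have "poly (rf_num ?G) ?s * poly ?q ?s = poly ?p ?s * poly (rf_den ?G) ?s"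
    using rf_num_mult_eq[OF nz(1) G] by (metis poly_mult)
  moreover have "poly ?p ?s = 0" "poly ?q ?s \<noteq> 0" using p q by (auto simp: poly_pcompose)
  ultimately have "poly (rf_num ?G) ?s = 0" by simp
  moreover have "Re ?s > 0" using s \<tau>(1) by simp
  ultimately show False using positive_real_imp_num_nonzero[OF \<tau>(2) nz(2)] by blast
qed

lemma strictly_positive_realI:
  assumes p: "p \<noteq> 0" and \<tau>: "\<tau> > 0"
    and real: "\<And>x::real. poly p (complex_of_real x) \<in> \<real>"
              "\<And>x::real. poly q (complex_of_real x) \<in> \<real>"
    and no_pole: "\<And>s. Re s > - \<tau> \<Longrightarrow> poly q s \<noteq> 0"
    and nonneg: "\<And>s. Re s > - \<tau> \<Longrightarrow> Re (poly p s / poly q s) \<ge> 0"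
  shows "strictly_positive_real (to_fract p / to_fract q)"
proof -
  let ?F = "to_fract p / to_fract q"
  let ?p = "pcompose p [:- complex_of_real \<tau>, 1:]"
  let ?q = "pcompose q [:- complex_of_real \<tau>, 1:]"
  have q0: "q \<noteq> 0" using no_pole[of 0] \<tau> by auto
  have G: "rf_shift \<tau> ?F = to_fract ?p / to_fract ?q" by (rule rf_shift_fraction[OF q0 refl])
  have nz: "poly ?q s \<noteq> 0" if "Re s > 0" for s
    using no_pole[of "s - complex_of_real \<tau>"] that by (simp add: poly_pcompose algebra_simps)
  have eval: "rf_eval (rf_shift \<tau> ?F) s =
      poly p (s - complex_of_real \<tau>) / poly q (s - complex_of_real \<tau>)" if "Re s > 0" for s
    using rf_eval_fraction[OF nz[OF that] G] by (simp add: poly_pcompose algebra_simps)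
  have "positive_real (rf_shift \<tau> ?F)"
    unfolding positive_real_def
  proof (intro conjI allI ballI impI)
    fix s assume "s \<in># rf_poles (rf_shift \<tau> ?F)"
    then show "\<not> 0 < Re s" using poly_rf_den_nonzero[OF nz G] by (auto simp: in_rf_poles_iff)
  next
    fix x :: real assume "x > 0"
    then show "rf_eval (rf_shift \<tau> ?F) (complex_of_real x) \<in> \<real>"
      using real[of "x - \<tau>"] by (simp add: eval Reals_divide)
  next
    fix s :: complex assume "Re s > 0"
    then show "Re (rf_eval (rf_shift \<tau> ?F) s) \<ge> 0"
      using nonneg[of "s - complex_of_real \<tau>"] by (simp add: eval)
  qed
  then show ?thesis using p q0 \<tau> by (auto simp: strictly_positive_real_def)
qed

section \<open>Hurwitz numerators and strictly positive real feedback loops\<close>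

text \<open>
  The fraction tends to 0 at infinity, and the rest of the half-plane is compact.
\<close>

lemma proper_fraction_bounded_on_halfplane:
  fixes p r :: "complex poly"
  assumes deg: "r = 0 \<or> degree r < degree p"
    and nz: "\<And>s. Re s \<ge> c \<Longrightarrow> poly p s \<noteq> 0"
  shows "\<exists>M. \<forall>s. Re s \<ge> c \<longrightarrow> norm (poly r s / poly p s) \<le> M"
proof (cases "r = 0")
  case True
  then show ?thesis by (intro exI[of _ 0]) auto
next
  case False
  have "((\<lambda>s. poly r s / poly p s) \<longlongrightarrow> 0) at_infinity"
    using False deg by (intro poly_divide_tendsto_0_at_infinity) auto
  then have "\<forall>\<^sub>F s in at_infinity. norm (poly r s / poly p s) < 1"
    using order_tendstoD(2)[OF tendsto_norm_zero, of _ _ 1] by simp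
  then obtain b where b: "\<And>s. norm s \<ge> b \<Longrightarrow> norm (poly r s / poly p s) < 1"
    by (auto simp: eventually_at_infinity)
  let ?K = "cball 0 b \<inter> {s. Re s \<ge> c}"
  have "compact ?K" using closed_halfspace_Re_ge[of c]
    by (intro compact_Int_closed) auto
  moreover have "continuous_on ?K (\<lambda>s. poly r s / poly p s)"
    using nz by (intro continuous_intros) auto
  ultimately have "bounded ((\<lambda>s. poly r s / poly p s) ` ?K)"
    by (intro compact_imp_bounded compact_continuous_image)
  then obtain M where "\<forall>z\<in>(\<lambda>s. poly r s / poly p s) ` ?K. norm z \<le> M"
    by (meson bounded_iff)
  then have M: "norm (poly r s / poly p s) \<le> M" if "s \<in> ?K" for s
    using that by blast
  show ?thesis
  proof (intro exI[of _ "max M 1"] allI impI)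
    fix s assume s: "c \<le> Re s"
    show "norm (poly r s / poly p s) \<le> max M 1"
    proof (cases "norm s \<le> b")
      case True
      then show ?thesis using M[of s] s by (simp add: le_max_iff_disj)
    next
      case False
      then show ?thesis using b[of s] by linarith
    qed
  qed
qed

text \<open>
  The analytic core. The hypothesis on \<open>Q\<close> says that \<open>Q/P\<close> is \<open>b s + c\<close> with \<open>b > 0\<close> plus a strictly
  proper fraction; for a Hurwitz \<open>P\<close> the real part of \<open>Q/P\<close> is then bounded below on a half-plane \<open>Re s > - \<tau>\<close>,
  and the gain \<open>g\<close> makes it positive.
\<close>

lemma hurwitz_iff_strictly_positive_real:
  fixes P Q R :: "complex poly" and b :: real and c :: complex
  assumes real: "\<And>x::real. poly P (complex_of_real x) \<in> \<real>"
              "\<And>x::real. poly Q (complex_of_real x) \<in> \<real>"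
    and no_common_root: "\<And>s. poly Q s = 0 \<Longrightarrow> poly P s \<noteq> 0"
    and P: "P \<noteq> 0" and b: "b > 0"
    and Q: "Q = [:c, complex_of_real b:] * P + R"
    and R: "R = 0 \<or> degree R < degree P"
  shows "(\<forall>s. poly P s = 0 \<longrightarrow> Re s < 0) \<longleftrightarrow>
    (\<exists>g::real. strictly_positive_real (to_fract P / to_fract (Q + smult (complex_of_real g) P)))"
proof
  assume "\<exists>g::real. strictly_positive_real (to_fract P / to_fract (Q + smult (complex_of_real g) P))"
  then obtain g :: real
    where g: "strictly_positive_real (to_fract P / to_fract (Q + smult (complex_of_real g) P))" ..
  show "\<forall>s. poly P s = 0 \<longrightarrow> Re s < 0"
  proof (intro allI impI)
    fix s assume s: "poly P s = 0"
    then have "poly (Q + smult (complex_of_real g) P) s \<noteq> 0"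
      using no_common_root[of s] by auto
    then show "Re s < 0"
      using strictly_positive_real_imp_num_nonzero[OF g] s by (meson not_le)
  qed
next
  assume stable: "\<forall>s. poly P s = 0 \<longrightarrow> Re s < 0"
  \<comment> \<open>No root of P has real part above - 2 \<tau>; the 1 keeps the set nonempty when P is constant.\<close>
  define \<tau> where "\<tau> = Min (insert 1 ((\<lambda>s. - Re s / 2) ` {s. poly P s = 0}))"
  have fin: "finite {s. poly P s = 0}" using P by (rule poly_roots_finite)
  have \<tau>: "\<tau> > 0" unfolding \<tau>_def using fin stable by (subst Min_gr_iff) auto
  have P_nz: "poly P s \<noteq> 0" if "Re s \<ge> - \<tau>" for s
  proof
    assume s: "poly P s = 0"
    then have "\<tau> \<le> - Re s / 2" unfolding \<tau>_def using fin by (intro Min_le) auto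
    moreover have "Re s < 0" using stable s by blast
    ultimately show False using that by linarith
  qed
  obtain M where M: "\<And>s. Re s \<ge> - \<tau> \<Longrightarrow> norm (poly R s / poly P s) \<le> M"
    using proper_fraction_bounded_on_halfplane[OF R, of "- \<tau>"] P_nz by blast
  \<comment> \<open>On Re s > - \<tau> the terms compensate b Re s, Re (R/P) and Re c; the 1 leaves a margin.\<close>
  define g where "g = b * \<tau> + M - Re c + 1"
  define Q' where "Q' = Q + smult (complex_of_real g) P"
  have inv: "Re (poly Q' s / poly P s) > 0" if s: "Re s > - \<tau>" for s
  proof -
    have "poly Q' s / poly P s = c + s * b + g + poly R s / poly P s"
      using P_nz[of s] s unfolding Q'_def Q by (simp add: field_simps)
    then have "Re (poly Q' s / poly P s) = Re c + Re s * b + g + Re (poly R s / poly P s)"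
      by simp
    moreover have "Re (poly R s / poly P s) \<ge> - M"
      using M[of s] s abs_Re_le_cmod[of "poly R s / poly P s"] by linarith
    moreover have "Re s * b \<ge> - \<tau> * b"
      using s b by (intro mult_right_mono) auto
    ultimately show ?thesis by (simp add: g_def algebra_simps)
  qed
  have "strictly_positive_real (to_fract P / to_fract Q')"
  proof (rule strictly_positive_realI[OF P \<tau>])
    fix x :: real
    show "poly P (complex_of_real x) \<in> \<real>" "poly Q' (complex_of_real x) \<in> \<real>"
      using real[of x] by (auto simp: Q'_def)
  next
    fix s assume s: "Re s > - \<tau>"
    show "poly Q' s \<noteq> 0" using inv[OF s] by auto
    have "poly P s / poly Q' s = inverse (poly Q' s / poly P s)" by simp
    then show "Re (poly P s / poly Q' s) \<ge> 0"
      using inv[OF s] by (simp only: inverse_complex.sel) (simp add: divide_nonneg_nonneg)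
  qed
  then show "\<exists>g::real. strictly_positive_real (to_fract P / to_fract (Q + smult (complex_of_real g) P))"
    unfolding Q'_def by blast
qed

lemma linear_quotient:
  fixes P Q :: "complex poly"
  assumes P: "degree P = m" "coeff P m = a" "a \<noteq> 0"
    and Q: "degree Q = Suc m" "lead_coeff Q = 1"
  shows "\<exists>c R. Q = [:c, 1 / a:] * P + R \<and> (R = 0 \<or> degree R < degree P)"
proof -
  \<comment> \<open>This c cancels the coefficient of R at m; the linear coefficient 1/a cancels that at m + 1.\<close>
  define c where "c = (coeff Q m - coeff (pCons 0 (smult (1 / a) P)) m) / a"
  define R where "R = Q - [:c, 1 / a:] * P"
  have coeff_R: "coeff R i = coeff Q i - c * coeff P i - coeff (pCons 0 (smult (1 / a) P)) i" for i
    by (simp add: R_def)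
  have R0: "coeff R i = 0" if "i \<ge> m" for i
  proof -
    have "i = m \<or> i = Suc m \<or> i > Suc m" using that by linarith
    then consider "i = m" | "i = Suc m" | "i > Suc m" by blast
    then show ?thesis
    proof cases
      case 1
      then show ?thesis using P by (simp add: coeff_R c_def)
    next
      case 2
      then show ?thesis using P Q by (simp add: coeff_R coeff_eq_0)
    next
      case 3
      then obtain j where "i = Suc j" "j > m" by (cases i) auto
      then show ?thesis using P Q by (simp add: coeff_R coeff_eq_0)
    qed
  qed
  have "R = 0 \<or> degree R < m" using R0[of "degree R"] by (meson leading_coeff_0_iff not_less)
  then show ?thesis using P by (intro exI[of _ c] exI[of _ R]) (simp add: R_def)
qed

lemma hurwitz_iff_feedback_strictly_positive_real:
  fixes P Q :: "complex poly" and a :: real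
  assumes real: "\<And>x::real. poly P (complex_of_real x) \<in> \<real>"
              "\<And>x::real. poly Q (complex_of_real x) \<in> \<real>"
    and no_common_root: "\<And>s. poly Q s = 0 \<Longrightarrow> poly P s \<noteq> 0"
    and P: "degree P = m" "coeff P m = complex_of_real a" "a > 0"
    and Q: "degree Q = Suc m" "lead_coeff Q = 1"
    and D: "D = to_fract P / to_fract Q"
  shows "(\<forall>s. poly P s = 0 \<longrightarrow> Re s < 0) \<longleftrightarrow>
    (\<exists>g::real. strictly_positive_real (D / (1 + rf_const (complex_of_real g) * D)))"
proof -
  have "Q \<noteq> 0" using Q by auto
  then have fb: "D / (1 + rf_const (complex_of_real g) * D) =
      to_fract P / to_fract (Q + smult (complex_of_real g) P)" for g
    by (simp add: D to_fract_smult divide_simps)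
  obtain c R where "Q = [:c, complex_of_real (1 / a):] * P + R" "R = 0 \<or> degree R < degree P"
    using linear_quotient[OF P(1,2) _ Q] P(3) by auto
  moreover have "P \<noteq> 0" using P by auto
  ultimately show ?thesis
    unfolding fb using P(3)
    by (intro hurwitz_iff_strictly_positive_real[where b = "1 / a" and c = c and R = R] real no_common_root)
      auto
qed

section \<open>Resolvents of constant matrices\<close>

text \<open>
  If some \<open>p i \<noteq> 0\<close> has degree at least that of \<open>q\<close>, take \<open>m\<close> such that \<open>p m\<close> has the largest degree:
  the left-hand side of its equation then has larger degree than the right-hand side. The case
  \<open>q = 0\<close> is allowed, and there the conclusion says that all \<open>p i\<close> vanish.
\<close>

lemma resolvent_numerator_degree:
  fixes p :: "nat \<Rightarrow> complex poly"
  assumes eq: "\<And>i. i < n \<Longrightarrow> [:0, 1:] * p i = smult (b i) q + (\<Sum>l<n. smult (a i l) (p l))"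
    and i: "i < n"
  shows "p i = 0 \<or> degree (p i) < degree q"
proof (rule ccontr)
  assume *: "\<not> ?thesis"
  define e where "e = Max ((\<lambda>l. degree (p l)) ` {l\<in>{..<n}. p l \<noteq> 0})"
  have le: "degree (p l) \<le> e" if "l < n" for l
    using that by (cases "p l = 0") (auto simp: e_def intro!: Max_ge)
  have "e \<in> (\<lambda>l. degree (p l)) ` {l\<in>{..<n}. p l \<noteq> 0}"
    unfolding e_def using i * by (intro Max_in) auto
  then obtain m where m: "m < n" "p m \<noteq> 0" "degree (p m) = e" by auto
  have "degree q \<le> e" using * le[OF i] by linarith
  then have "degree (smult (b m) q + (\<Sum>l<n. smult (a m l) (p l))) \<le> e"
    using le by (intro degree_add_le degree_sum_le) (auto intro: order_trans[OF degree_smult_le])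
  moreover have "degree ([:0, 1:] * p m) = Suc e"
    using m by (subst degree_mult_eq) auto
  ultimately show False by (metis eq[OF m(1)] Suc_n_not_le_n)
qed

lemma resolvent_polynomial_form:
  fixes x :: "nat \<Rightarrow> ratfun"
  assumes x: "\<And>i. i < n \<Longrightarrow> rf_var * x i = rf_const (b i) + (\<Sum>l<n. rf_const (a i l) * x l)"
  shows "\<exists>p q. q \<noteq> 0 \<and> (\<forall>i<n. x i = to_fract (p i) / to_fract q) \<and>
    (\<forall>i<n. [:0, 1:] * p i = smult (b i) q + (\<Sum>l<n. smult (a i l) (p l)))"
proof -
  obtain p q where q: "q \<noteq> 0" and p: "\<And>i. i < n \<Longrightarrow> x i = to_fract (p i) / to_fract q"
    using common_denominator[of n x] by auto
  have xq: "x i * to_fract q = to_fract (p i)" if "i < n" for i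
    using q p[OF that] by simp
  have "[:0, 1:] * p i = smult (b i) q + (\<Sum>l<n. smult (a i l) (p l))" if i: "i < n" for i
  proof -
    have "to_fract ([:0, 1:] * p i) = rf_var * to_fract (p i)"
      by (simp only: to_fract_mult rf_var_def)
    also have "\<dots> = rf_var * x i * to_fract q"
      by (simp only: xq[OF i] mult.assoc)
    also have "\<dots> = rf_const (b i) * to_fract q + (\<Sum>l<n. rf_const (a i l) * (x l * to_fract q))"
      by (simp only: x[OF i] distrib_right sum_distrib_right mult.assoc)
    also have "(\<Sum>l<n. rf_const (a i l) * (x l * to_fract q)) = (\<Sum>l<n. rf_const (a i l) * to_fract (p l))"
      using xq by (intro sum.cong) auto
    also have "rf_const (b i) * to_fract q + \<dots> = 
      to_fract (smult (b i) q + (\<Sum>l<n. smult (a i l) (p l)))"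
      by (simp only: to_fract_add to_fract_sum to_fract_smult)
    finally show ?thesis by (simp only: to_fract_eq_iff)
  qed
  with p q show ?thesis by blast
qed

text \<open>
  A constant matrix has no eigenvector with eigenvalue \<open>s\<close> over the field of rational functions.
\<close>

lemma resolvent_homogeneous_zero:
  fixes x :: "nat \<Rightarrow> ratfun"
  assumes x: "\<And>i. i < n \<Longrightarrow> rf_var * x i = (\<Sum>l<n. rf_const (a i l) * x l)" and i: "i < n"
  shows "x i = 0"
proof -
  have x': "rf_var * x i = rf_const 0 + (\<Sum>l<n. rf_const (a i l) * x l)" if "i < n" for i
    using x[OF that] by simp
  obtain p q where q: "q \<noteq> 0" and p: "\<And>i. i < n \<Longrightarrow> x i = to_fract (p i) / to_fract q"
    and eq: "\<forall>i<n. [:0, 1:] * p i = smult 0 q + (\<Sum>l<n. smult (a i l) (p l))"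
    using resolvent_polynomial_form[of n x "\<lambda>_. 0" a, OF x'] by auto
  have "p i = 0" using resolvent_numerator_degree[of n p "\<lambda>_. 0" 0 a i] eq i by simp
  then show ?thesis using p[OF i] by simp
qed

lemma sum_resolvent_row:
  fixes f :: "nat \<Rightarrow> ratfun"
  assumes A: "A \<in> carrier_mat n n" and i: "i < n"
  shows "(\<Sum>l<n. (rf_var \<cdot>\<^sub>m 1\<^sub>m n - rf_mat A) $$ (i, l) * f l) =
    rf_var * f i - (\<Sum>l<n. rf_const (complex_of_real (A $$ (i, l))) * f l)"
proof -
  have "(\<Sum>l<n. (rf_var \<cdot>\<^sub>m 1\<^sub>m n - rf_mat A) $$ (i, l) * f l) =
    (\<Sum>l<n. (if l = i then rf_var * f l else 0) - rf_const (complex_of_real (A $$ (i, l))) * f l)"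
    using A i by (intro sum.cong) (auto simp: rf_mat_def left_diff_distrib)
  then show ?thesis using i by (simp add: sum_subtractf)
qed

lemma mat_inverse_resolvent:
  assumes A: "A \<in> carrier_mat n n"
  defines "M \<equiv> rf_var \<cdot>\<^sub>m 1\<^sub>m n - rf_mat A"
  shows "M * the (mat_inverse M) = 1\<^sub>m n" "the (mat_inverse M) \<in> carrier_mat n n"
proof -
  have M: "M \<in> carrier_mat n n" using A by (auto simp: M_def rf_mat_def)
  have "det M \<noteq> 0"
  proof
    assume "det M = 0"
    then obtain v where v: "v \<in> carrier_vec n" "v \<noteq> 0\<^sub>v n" "M *\<^sub>v v = 0\<^sub>v n"
      using det_0_iff_vec_prod_zero[OF M] by auto
    have eq: "rf_var * v $ i = (\<Sum>l<n. rf_const (complex_of_real (A $$ (i, l))) * v $ l)"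
      if i: "i < n" for i
    proof -
      have "0 = (M *\<^sub>v v) $ i" using v(3) i by simp
      also have "\<dots> = (\<Sum>l<n. M $$ (i, l) * v $ l)"
        using M v(1) i by (simp add: scalar_prod_def atLeast0LessThan)
      finally show ?thesis using sum_resolvent_row[OF A i, of "\<lambda>l. v $ l"] by (simp add: M_def)
    qed
    have "v = 0\<^sub>v n"
      using v(1) by (intro eq_vecI)
        (auto intro: resolvent_homogeneous_zero[of n "\<lambda>l. v $ l" "\<lambda>i l. complex_of_real (A $$ (i, l))", OF eq])
    then show False using v(2) by simp
  qed
  then have "M \<in> Units (ring_mat TYPE(ratfun) n ())" by (rule det_non_zero_imp_unit[OF M])
  then obtain X where X: "mat_inverse M = Some X" using mat_inverse(1)[OF M, where b = "()"] by (cases "mat_inverse M") auto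
  show "M * the (mat_inverse M) = 1\<^sub>m n" "the (mat_inverse M) \<in> carrier_mat n n"
    using mat_inverse(2)[OF M X] X by auto
qed

text \<open>
  The transfer function is \<open>C x\<close>, where the state \<open>x = (sI - A)\<^sup>-\<^sup>1 B\<close> solves \<open>s x = B + A x\<close>.
\<close>

lemma transfer_function_state:
  assumes A: "A \<in> carrier_mat n n" and B: "B \<in> carrier_mat n 1" and C: "C \<in> carrier_mat 1 n"
  shows "\<exists>x. (\<forall>i<n. rf_var * x i = rf_const (complex_of_real (B $$ (i, 0))) +
                 (\<Sum>l<n. rf_const (complex_of_real (A $$ (i, l))) * x l)) \<and>
             transfer_function A B C = (\<Sum>i<n. rf_const (complex_of_real (C $$ (0, i))) * x i)"
proof -
  define M where "M = rf_var \<cdot>\<^sub>m 1\<^sub>m n - rf_mat A"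
  define X where "X = the (mat_inverse M)"
  define Y where "Y = X * rf_mat B"
  note X = mat_inverse_resolvent[OF A, folded M_def, folded X_def]
  have M: "M \<in> carrier_mat n n" using A by (auto simp: M_def rf_mat_def)
  have B': "rf_mat B \<in> carrier_mat n 1" and C': "rf_mat C \<in> carrier_mat 1 n"
    using B C by (auto simp: rf_mat_def)
  have Y: "Y \<in> carrier_mat n 1" using X B' by (auto simp: Y_def)
  have "M * Y = (M * X) * rf_mat B"
    unfolding Y_def by (rule assoc_mult_mat[symmetric, OF M X(2) B'])
  also have "\<dots> = rf_mat B" using X(1) B' by simp
  finally have MY: "M * Y = rf_mat B" .
  have "rf_var * Y $$ (i, 0) = rf_const (complex_of_real (B $$ (i, 0))) +
      (\<Sum>l<n. rf_const (complex_of_real (A $$ (i, l))) * Y $$ (l, 0))" if i: "i < n" for i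
  proof -
    have "rf_const (complex_of_real (B $$ (i, 0))) = (M * Y) $$ (i, 0)"
      using B i by (simp add: MY rf_mat_def)
    also have "\<dots> = (\<Sum>l<n. M $$ (i, l) * Y $$ (l, 0))"
      using M Y i by (simp add: scalar_prod_def atLeast0LessThan)
    finally show ?thesis
      using sum_resolvent_row[OF A i, of "\<lambda>l. Y $$ (l, 0)"] by (simp add: M_def)
  qed
  moreover have "transfer_function A B C = (\<Sum>i<n. rf_const (complex_of_real (C $$ (0, i))) * Y $$ (i, 0))"
  proof -
    have "transfer_function A B C = (rf_mat C * Y) $$ (0, 0)"
      using A X C' B' unfolding transfer_function_def Y_def X_def M_def by (simp add: assoc_mult_mat)
    also have "\<dots> = (\<Sum>i<n. rf_const (complex_of_real (C $$ (0, i))) * Y $$ (i, 0))"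
      using C Y by (simp add: scalar_prod_def atLeast0LessThan rf_mat_def)
    finally show ?thesis .
  qed
  ultimately show ?thesis
    by (intro exI[of _ "\<lambda>i. Y $$ (i, 0)"]) simp
qed

text \<open>
  With \<open>E\<close> the transfer function of the closed loop, the closed-loop state solves the open-loop
  equation with input scaled by \<open>1 - g E\<close>. By uniqueness it is \<open>1 - g E\<close> times the open-loop state,
  so \<open>E = (1 - g E) D\<close>. In particular \<open>1 + g D\<close> cannot vanish.
\<close>

lemma transfer_function_feedback:
  assumes A: "A \<in> carrier_mat n n" and B: "B \<in> carrier_mat n 1" and C: "C \<in> carrier_mat 1 n"
  defines "D \<equiv> transfer_function A B C"
  shows "transfer_function (A - g \<cdot>\<^sub>m (B * C)) B C = D / (1 + rf_const (complex_of_real g) * D)"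
proof -
  define a b c where "a = (\<lambda>i l. rf_const (complex_of_real (A $$ (i, l))))"
    and "b = (\<lambda>i. rf_const (complex_of_real (B $$ (i, 0))))"
    and "c = (\<lambda>i. rf_const (complex_of_real (C $$ (0, i))))"
  define \<gamma> where "\<gamma> = rf_const (complex_of_real g)"
  define E where "E = transfer_function (A - g \<cdot>\<^sub>m (B * C)) B C"
  have A': "A - g \<cdot>\<^sub>m (B * C) \<in> carrier_mat n n" using A B C by auto
  have a': "rf_const (complex_of_real ((A - g \<cdot>\<^sub>m (B * C)) $$ (i, l))) = a i l - \<gamma> * (b i * c l)"
    if "i < n" "l < n" for i l
    using A B C that by (simp add: a_def b_def c_def \<gamma>_def scalar_prod_def)
  obtain x where x: "\<And>i. i < n \<Longrightarrow> rf_var * x i = b i + (\<Sum>l<n. a i l * x l)"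
    and D: "D = (\<Sum>i<n. c i * x i)"
    using transfer_function_state[OF A B C] unfolding a_def b_def c_def D_def by auto
  obtain y where y: "\<And>i. i < n \<Longrightarrow> rf_var * y i = b i +
      (\<Sum>l<n. rf_const (complex_of_real ((A - g \<cdot>\<^sub>m (B * C)) $$ (i, l))) * y l)"
    and E: "E = (\<Sum>i<n. c i * y i)"
    using transfer_function_state[OF A' B C] unfolding b_def c_def E_def by auto
  have y': "rf_var * y i = b i * (1 - \<gamma> * E) + (\<Sum>l<n. a i l * y l)" if i: "i < n" for i
  proof -
    have "rf_var * y i = b i + (\<Sum>l<n. a i l * y l - \<gamma> * b i * (c l * y l))"
      unfolding y[OF i] by (intro arg_cong2[where f = "(+)"] sum.cong refl)
        (simp add: a'[OF i] left_diff_distrib mult.assoc del: index_minus_mat)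
    also have "\<dots> = b i * (1 - \<gamma> * E) + (\<Sum>l<n. a i l * y l)"
      by (simp add: E sum_subtractf sum_distrib_left algebra_simps)
    finally show ?thesis .
  qed
  have "y i - (1 - \<gamma> * E) * x i = 0" if i: "i < n" for i
  proof (rule resolvent_homogeneous_zero[OF _ i])
    fix i assume i: "i < n"
    have "rf_var * (y i - (1 - \<gamma> * E) * x i) = rf_var * y i - (1 - \<gamma> * E) * (rf_var * x i)"
      by (simp add: algebra_simps)
    also have "\<dots> = (\<Sum>l<n. a i l * y l) - (1 - \<gamma> * E) * (\<Sum>l<n. a i l * x l)"
      unfolding y'[OF i] x[OF i] by (simp add: algebra_simps)
    also have "\<dots> = (\<Sum>l<n. a i l * (y l - (1 - \<gamma> * E) * x l))"
      by (simp add: sum_distrib_left sum_subtractf sum.distrib algebra_simps)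
    finally show "rf_var * (y i - (1 - \<gamma> * E) * x i) =
      (\<Sum>l<n. rf_const (complex_of_real (A $$ (i, l))) * (y l - (1 - \<gamma> * E) * x l))"
      by (simp only: a_def)
  qed
  then have "(\<Sum>i<n. c i * y i) = (\<Sum>i<n. (1 - \<gamma> * E) * (c i * x i))"
    by (intro sum.cong) (auto simp: mult.left_commute)
  then have "E = (1 - \<gamma> * E) * D"
    unfolding D E[symmetric] sum_distrib_left .
  then have "E - (1 - \<gamma> * E) * D = 0"
    by (rule iffD2[OF right_minus_eq])
  also have "E - (1 - \<gamma> * E) * D = E * (1 + \<gamma> * D) - D"
    by (simp add: algebra_simps)
  finally have eq: "E * (1 + \<gamma> * D) = D"
    by (rule iffD1[OF right_minus_eq])
  then have "1 + \<gamma> * D \<noteq> 0" by auto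
  then have "E = D / (1 + \<gamma> * D)" using eq by (simp add: eq_divide_eq)
  then show ?thesis by (simp add: E_def \<gamma>_def)
qed

lemma coeff_mult_of_degree_le:
  fixes p q :: "'a :: comm_semiring_1 poly"
  assumes "degree p \<le> m" "degree q \<le> n"
  shows "coeff (p * q) (m + n) = coeff p m * coeff q n"
proof -
  have "coeff (p * q) (m + n) = (\<Sum>i\<le>m + n. coeff p i * coeff q (m + n - i))"
    by (rule coeff_mult)
  also have "\<dots> = (\<Sum>i\<le>m + n. if i = m then coeff p m * coeff q n else 0)"
  proof (intro sum.cong refl)
    fix i
    have "coeff p i = 0" if "i > m" using that assms by (simp add: coeff_eq_0)
    moreover have "coeff q (m + n - i) = 0" if "i < m" using that assms by (simp add: coeff_eq_0)
    ultimately show "coeff p i * coeff q (m + n - i) = (if i = m then coeff p m * coeff q n else 0)"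
      by (cases i m rule: linorder_cases) auto
  qed
  finally show ?thesis by simp
qed

text \<open>
  The first Markov parameter: \<open>D\<close> behaves like \<open>CB/s\<close> at infinity. The state is \<open>p/q\<close> with
  \<open>s p = q B + A p\<close> and \<open>p\<close> of degree below that of \<open>q\<close>; hence at \<open>degree q\<close> the polynomial \<open>s C p\<close> has
  coefficient \<open>CB\<close> times the leading coefficient of \<open>q\<close>, and \<open>P q = (C p) Q\<close> transfers this to \<open>P\<close>.
\<close>

lemma coeff_transfer_function:
  fixes P Q :: "complex poly"
  assumes A: "A \<in> carrier_mat n n" and B: "B \<in> carrier_mat n 1" and C: "C \<in> carrier_mat 1 n"
    and D: "transfer_function A B C = to_fract P / to_fract Q"
    and P: "degree P \<le> m" and Q: "degree Q = Suc m" "lead_coeff Q = 1"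
  shows "coeff P m = complex_of_real ((C * B) $$ (0, 0))"
proof -
  define a b c where "a = (\<lambda>i l. complex_of_real (A $$ (i, l)))"
    and "b = (\<lambda>i. complex_of_real (B $$ (i, 0)))"
    and "c = (\<lambda>i. complex_of_real (C $$ (0, i)))"
  obtain x where x: "\<And>i. i < n \<Longrightarrow> rf_var * x i = rf_const (b i) + (\<Sum>l<n. rf_const (a i l) * x l)"
    and Dx: "to_fract P / to_fract Q = (\<Sum>i<n. rf_const (c i) * x i)"
    using transfer_function_state[OF A B C] D unfolding a_def b_def c_def by auto
  obtain p q where q: "q \<noteq> 0" and p: "\<And>i. i < n \<Longrightarrow> x i = to_fract (p i) / to_fract q"
    and eq: "\<And>i. i < n \<Longrightarrow> [:0, 1:] * p i = smult (b i) q + (\<Sum>l<n. smult (a i l) (p l))"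
    using resolvent_polynomial_form[of n x b a, OF x] by auto
  define d where "d = degree q"
  have deg: "p i = 0 \<or> degree (p i) < d" if "i < n" for i
    unfolding d_def by (rule resolvent_numerator_degree[of n p b q a i, OF eq that])
  then have p0: "coeff (p i) d = 0" if "i < n" for i
    using deg[OF that] by (auto simp: coeff_eq_0)
  define S where "S = (\<Sum>i<n. smult (c i) (p i))"
  have lead: "coeff (pCons 0 (p i)) d = b i * lead_coeff q" if i: "i < n" for i
  proof -
    have "coeff ([:0, 1:] * p i) d = b i * lead_coeff q + (\<Sum>l<n. a i l * coeff (p l) d)"
      unfolding eq[OF i] by (simp add: coeff_sum d_def)
    then show ?thesis using p0 by simp
  qed
  have "pCons 0 S = (\<Sum>i<n. smult (c i) (pCons 0 (p i)))"
    by (rule poly_eqI) (simp add: S_def coeff_sum coeff_pCons split: nat.split)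
  then have "coeff (pCons 0 S) d = (\<Sum>i<n. c i * coeff (pCons 0 (p i)) d)"
    by (simp only: coeff_sum coeff_smult)
  also have "\<dots> = (\<Sum>i<n. c i * (b i * lead_coeff q))"
    using lead by (intro sum.cong) auto
  also have "\<dots> = complex_of_real ((C * B) $$ (0, 0)) * lead_coeff q"
    using B C by (simp add: b_def c_def scalar_prod_def atLeast0LessThan sum_distrib_right mult.assoc)
  finally have S: "coeff (pCons 0 S) d = complex_of_real ((C * B) $$ (0, 0)) * lead_coeff q" .
  have "Q \<noteq> 0" using Q by auto
  have "to_fract P / to_fract Q = (\<Sum>i<n. rf_const (c i) * to_fract (p i) / to_fract q)"
    unfolding Dx using p by (intro sum.cong) auto
  also have "\<dots> = to_fract S / to_fract q"
    by (simp add: S_def to_fract_smult sum_divide_distrib)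
  finally have PS: "P * q = S * Q"
    using q \<open>Q \<noteq> 0\<close> by (simp add: to_fract_divide_eq_iff)
  have deg_S: "degree (pCons 0 S) \<le> d"
  proof (cases "d = 0")
    case True
    then have "S = 0" using deg by (auto simp: S_def)
    then show ?thesis by simp
  next
    case False
    have "degree S \<le> d - 1"
      unfolding S_def using deg
      by (intro degree_sum_le) (fastforce intro: order_trans[OF degree_smult_le])+
    then show ?thesis using False by (auto simp: degree_pCons_eq_if)
  qed
  have "coeff P m * lead_coeff q = coeff (pCons 0 (P * q)) (d + Suc m)"
    using coeff_mult_of_degree_le[OF P, of q d] by (simp add: d_def add.commute)
  also have "pCons 0 (P * q) = pCons 0 S * Q"
    using PS by simp
  also have "coeff \<dots> (d + Suc m) = coeff (pCons 0 S) d * coeff Q (Suc m)"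
    using Q by (intro coeff_mult_of_degree_le deg_S) simp
  finally show ?thesis using S Q q by simp
qed

section \<open>Sums over conjugate pairs of poles\<close>

text \<open>
  The denominator \<open>(s - jl) (s + jl) = s\<^sup>2 + l\<^sup>2\<close> of a pair of conjugate imaginary poles.
\<close>

definition pair_den :: "real \<Rightarrow> complex poly" where
  "pair_den l = [:complex_of_real (l\<^sup>2), 0, 1:]"

text \<open>
  The numerator of \<open>u / (s - jl) + cnj u / (s + jl)\<close> over that denominator.
\<close>

definition pair_num :: "real \<Rightarrow> complex \<Rightarrow> complex poly" where
  "pair_num l u = smult u [:\<i> * complex_of_real l, 1:] + smult (cnj u) [:- (\<i> * complex_of_real l), 1:]"

text \<open>
  The product of the pair denominators over an index set.
\<close>

definition common_den :: "'i set \<Rightarrow> ('i \<Rightarrow> real) \<Rightarrow> complex poly" where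
  "common_den I l = (\<Prod>i\<in>I. pair_den (l i))"

text \<open>
  The numerator, over \<open>common_den I l\<close>, of the sum of the pair contributions with weights \<open>u\<close>.
  It is not reduced: cancellation is possible when some \<open>u i\<close> vanishes or the \<open>l i\<close> repeat.
\<close>

definition common_num :: "'i set \<Rightarrow> ('i \<Rightarrow> real) \<Rightarrow> ('i \<Rightarrow> complex) \<Rightarrow> complex poly" where
  "common_num I l u = (\<Sum>i\<in>I. pair_num (l i) (u i) * common_den (I - {i}) l)"

lemma pair_den_factor: "pair_den l = [:\<i> * complex_of_real l, 1:] * [:- (\<i> * complex_of_real l), 1:]"
  by (simp add: pair_den_def power2_eq_square complex_eq_iff)

lemma pair_den_nonzero [simp]: "pair_den l \<noteq> 0"
  by (simp add: pair_den_def)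

lemma common_den_nonzero [simp]: "finite I \<Longrightarrow> common_den I l \<noteq> 0"
  by (simp add: common_den_def)

lemma degree_common_den: "degree (common_den I l) = 2 * card I"
  unfolding common_den_def by (subst degree_prod_sum_eq) (auto simp: pair_den_def)

lemma lead_coeff_common_den: "lead_coeff (common_den I l) = 1"
  unfolding common_den_def by (simp only: lead_coeff_prod) (simp add: pair_den_def)

lemma degree_common_num: "degree (common_num I l u) \<le> 2 * card I - 1"
proof (cases "finite I")
  case True
  show ?thesis unfolding common_num_def
  proof (intro degree_sum_le True)
    fix i assume i: "i \<in> I"
    have "degree (pair_num (l i) (u i)) \<le> 1" by (simp add: pair_num_def)
    moreover have "degree (common_den (I - {i}) l) = 2 * (card I - 1)"
      using True i by (simp add: degree_common_den)
    moreover have "card I \<ge> 1" using True i by (metis One_nat_def Suc_leI card_gt_0_iff empty_iff)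
    ultimately show "degree (pair_num (l i) (u i) * common_den (I - {i}) l) \<le> 2 * card I - 1"
      using degree_mult_le[of "pair_num (l i) (u i)" "common_den (I - {i}) l"] by linarith
  qed
qed (simp add: common_num_def)

lemma poly_common_den_real: "poly (common_den I l) (complex_of_real x) \<in> \<real>"
  by (auto simp: common_den_def pair_den_def poly_prod intro!: prod_in_Reals)

lemma poly_common_num_real: "poly (common_num I l u) (complex_of_real x) \<in> \<real>"
proof -
  have "poly (pair_num (l i) (u i)) (complex_of_real x) \<in> \<real>" for i
    by (simp add: pair_num_def Reals_cnj_iff algebra_simps)
  then show ?thesis
    by (auto simp: common_num_def poly_sum poly_common_den_real intro!: sum_in_Reals)
qed

text \<open>
  At a root \<open>\<plusminus> j l\<^sub>m\<close> of the denominator only the \<open>m\<close>-th summand of the numerator survives, and its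
  factors are nonzero because \<open>u\<^sub>m \<noteq> 0\<close>, \<open>l\<^sub>m \<noteq> 0\<close> and the squares \<open>l\<^sub>i\<^sup>2\<close> are distinct.
\<close>

lemma common_den_common_num_no_common_root:
  assumes I: "finite I" "inj_on l I" "\<And>i. i \<in> I \<Longrightarrow> l i > 0" "\<And>i. i \<in> I \<Longrightarrow> u i \<noteq> 0"
    and s: "poly (common_den I l) s = 0"
  shows "poly (common_num I l u) s \<noteq> 0"
proof -
  obtain m where m: "m \<in> I" "poly (pair_den (l m)) s = 0"
    using s I(1) by (auto simp: common_den_def poly_prod)
  then have s2: "s\<^sup>2 = - complex_of_real ((l m)\<^sup>2)"
    by (simp add: pair_den_def power2_eq_square add_eq_0_iff)
  have "s = \<i> * complex_of_real (l m) \<or> s = - (\<i> * complex_of_real (l m))"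
    using m(2) unfolding pair_den_factor poly_mult mult_eq_0_iff by (auto simp: add_eq_0_iff)
  then have "poly (pair_num (l m) (u m)) s \<noteq> 0"
  proof
    assume s: "s = \<i> * complex_of_real (l m)"
    have "poly (pair_num (l m) (u m)) s = 2 * u m * (\<i> * complex_of_real (l m))"
      unfolding s by (simp add: pair_num_def algebra_simps)
    then show ?thesis using I(3,4)[OF m(1)] by simp
  next
    assume s: "s = - (\<i> * complex_of_real (l m))"
    have "poly (pair_num (l m) (u m)) s = - 2 * cnj (u m) * (\<i> * complex_of_real (l m))"
      unfolding s by (simp add: pair_num_def algebra_simps)
    then show ?thesis using I(3,4)[OF m(1)] by simp
  qed
  moreover have "poly (common_den (I - {m}) l) s \<noteq> 0"
  proof -
    have "poly (pair_den (l i)) s \<noteq> 0" if i: "i \<in> I - {m}" for i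
    proof
      assume "poly (pair_den (l i)) s = 0"
      then have "s\<^sup>2 = - complex_of_real ((l i)\<^sup>2)"
        by (simp add: pair_den_def power2_eq_square add_eq_0_iff)
      then have "(l i)\<^sup>2 = (l m)\<^sup>2" using s2 by (metis neg_equal_iff_equal of_real_eq_iff)
      then have "l i = l m" using I(3)[of i] I(3)[of m] i m by (simp add: power2_eq_iff)
      then show False using I(2) i m by (auto dest: inj_onD)
    qed
    then show ?thesis using I(1) by (auto simp: common_den_def poly_prod)
  qed
  moreover have "poly (pair_num (l i) (u i) * common_den (I - {i}) l) s = 0" if "i \<in> I - {m}" for i
    using that m I(1) by (auto simp: common_den_def poly_prod)
  then have "(\<Sum>i\<in>I - {m}. poly (pair_num (l i) (u i) * common_den (I - {i}) l) s) = 0"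
    by (intro sum.neutral) blast
  then have "poly (common_num I l u) s = poly (pair_num (l m) (u m) * common_den (I - {m}) l) s"
    unfolding common_num_def poly_sum by (simp only: sum.remove[OF I(1) m(1)] add_0_right)
  ultimately show ?thesis by simp
qed

lemma sum_conjugate_pole_pairs:
  assumes I: "finite I"
  shows "(\<Sum>i\<in>I. rf_const (u i) / (rf_var - rf_const (\<i> * complex_of_real (l i)))
            + rf_const (cnj (u i)) / (rf_var + rf_const (\<i> * complex_of_real (l i))))
     = to_fract (common_num I l u) / to_fract (common_den I l)"
proof -
  have "rf_const (u i) / (rf_var - rf_const (\<i> * complex_of_real (l i)))
            + rf_const (cnj (u i)) / (rf_var + rf_const (\<i> * complex_of_real (l i)))
      = to_fract (pair_num (l i) (u i) * common_den (I - {i}) l) / to_fract (common_den I l)"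
    if i: "i \<in> I" for i
  proof -
    let ?m = "[:- (\<i> * complex_of_real (l i)), 1:]" and ?p = "[:\<i> * complex_of_real (l i), 1:]"
    have m: "rf_var - rf_const (\<i> * complex_of_real (l i)) = to_fract ?m"
      unfolding rf_var_def rf_const_def to_fract_diff[symmetric] by simp
    have p: "rf_var + rf_const (\<i> * complex_of_real (l i)) = to_fract ?p"
      unfolding rf_var_def rf_const_def to_fract_add[symmetric] by simp
    have nz: "to_fract ?m \<noteq> 0" "to_fract ?p \<noteq> 0" "to_fract (common_den (I - {i}) l) \<noteq> 0"
      using I by auto
    have "rf_const (u i) / to_fract ?m + rf_const (cnj (u i)) / to_fract ?p
      = (rf_const (u i) * to_fract ?p + rf_const (cnj (u i)) * to_fract ?m) / (to_fract ?p * to_fract ?m)"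
      using nz by (simp add: add_frac_eq mult.commute)
    also have "\<dots> = to_fract (pair_num (l i) (u i)) / to_fract (pair_den (l i))"
      unfolding pair_num_def pair_den_factor to_fract_add to_fract_mult to_fract_smult ..
    also have "\<dots> = to_fract (pair_num (l i) (u i) * common_den (I - {i}) l) /
                    to_fract (pair_den (l i) * common_den (I - {i}) l)"
      using nz(3) unfolding to_fract_mult by (rule mult_divide_mult_cancel_right[symmetric])
    also have "pair_den (l i) * common_den (I - {i}) l = common_den I l"
      unfolding common_den_def by (rule prod.remove[symmetric, OF I i])
    finally show ?thesis unfolding m p .
  qed
  then show ?thesis
    by (simp only: common_num_def to_fract_sum sum_divide_distrib cong: sum.cong)
qed

section \<open>Stability and strict positive realness\<close>

theorem lemma4p4:
  fixes k :: nat
    and lam :: "nat \<Rightarrow> real"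
    and h w :: "nat \<Rightarrow> complex"
    and N D H :: ratfun
    and A B C :: "real mat"
  assumes k: "k \<ge> 1"
    and lam_pos: "\<And>i. i \<in> {1..k} \<Longrightarrow> lam i > 0"
    and lam_distinct: "inj_on lam {1..k}"
    and w_nonzero: "\<And>i. i \<in> {1..k} \<Longrightarrow> w i \<noteq> 0"
    and N: "N = (\<Sum>i=1..k.
              rf_const (h i * w i) / (rf_var - rf_const (\<i> * complex_of_real (lam i)))
            + rf_const (cnj (h i * w i)) / (rf_var + rf_const (\<i> * complex_of_real (lam i))))"
    and D: "D = (\<Sum>i=1..k.
              rf_const (w i) / (rf_var - rf_const (\<i> * complex_of_real (lam i)))
            + rf_const (cnj (w i)) / (rf_var + rf_const (\<i> * complex_of_real (lam i))))"
    and H: "H = N / D"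
    and A: "A \<in> carrier_mat (2 * k) (2 * k)"
    and B: "B \<in> carrier_mat (2 * k) 1"
    and C: "C \<in> carrier_mat 1 (2 * k)"
    and realization: "D = transfer_function A B C"
    and num_poles: "size (rf_poles H) = 2 * k - 1"
  shows "(\<forall>g::real. D / (1 + rf_const (complex_of_real g) * D)
                    = transfer_function (A - g \<cdot>\<^sub>m (B * C)) B C) \<and>
         (\<forall>g::real. - D / (1 - rf_const (complex_of_real g) * D)
                    = - transfer_function (A + g \<cdot>\<^sub>m (B * C)) B C) \<and>
         (asymptotically_stable H \<longleftrightarrow>
            ((C * B) $$ (0, 0) > 0 \<and>
             (\<exists>g::real. strictly_positive_real
                (D / (1 + rf_const (complex_of_real g) * D)))) \<or>
            ((C * B) $$ (0, 0) < 0 \<and>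
             (\<exists>g::real. strictly_positive_real
                (- D / (1 - rf_const (complex_of_real g) * D)))))"
proof -
  define P where "P = common_num {1..k} lam w"
  define Q where "Q = common_den {1..k} lam"
  define R where "R = common_num {1..k} lam (\<lambda>i. h i * w i)"
  define m where "m = 2 * k - 1"
  define \<beta> where "\<beta> = (C * B) $$ (0, 0)"
  have DPQ: "D = to_fract P / to_fract Q"
    unfolding D P_def Q_def by (rule sum_conjugate_pole_pairs) simp
  have NRQ: "N = to_fract R / to_fract Q"
    unfolding N R_def Q_def by (rule sum_conjugate_pole_pairs) simp
  have Q: "degree Q = Suc m" "lead_coeff Q = 1" and Q0: "Q \<noteq> 0"
    using k lead_coeff_common_den[of "{1..k}" lam] by (simp_all add: Q_def m_def degree_common_den)
  have P_le: "degree P \<le> m"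
    using degree_common_num[of "{1..k}" lam w] by (simp add: P_def m_def)
  have real: "poly P (complex_of_real x) \<in> \<real>" "poly Q (complex_of_real x) \<in> \<real>" for x
    by (simp_all add: P_def Q_def poly_common_num_real poly_common_den_real)
  have no_common_root: "poly P s \<noteq> 0" if "poly Q s = 0" for s
    using that lam_pos lam_distinct w_nonzero unfolding P_def Q_def
    by (intro common_den_common_num_no_common_root) auto
  have "P \<noteq> 0"
  proof
    assume "P = 0"
    then have "H = 0" by (simp add: H DPQ)
    then have "rf_poles H = {#}" by (simp add: rf_poles_def rf_den_def)
    then show False using num_poles k by simp
  qed
  have HRP: "H = to_fract R / to_fract P"
    unfolding H NRQ DPQ using Q0 by simp
  \<comment> \<open>The pole count leaves no room for cancellation in R/P nor for a drop in the degree of P.\<close>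
  have "m \<le> degree (rf_den H)"
    using num_poles size_proots_le[of "rf_den H"] by (simp add: rf_poles_def m_def)
  moreover have dvd: "rf_den H dvd P" by (rule rf_den_dvd[OF \<open>P \<noteq> 0\<close> HRP])
  ultimately have deg: "degree P = m" "degree (rf_den H) = degree P"
    using P_le dvd_imp_degree_le[OF dvd \<open>P \<noteq> 0\<close>] by auto
  obtain v where v: "P = rf_den H * v" using dvd by blast
  have "degree v = 0" using v \<open>P \<noteq> 0\<close> deg(2) by (simp add: degree_mult_eq)
  then have roots: "poly (rf_den H) s = 0 \<longleftrightarrow> poly P s = 0" for s
    using v \<open>P \<noteq> 0\<close> by (auto elim!: degree_eq_zeroE)
  have stable: "asymptotically_stable H \<longleftrightarrow> (\<forall>s. poly P s = 0 \<longrightarrow> Re s < 0)"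
    by (auto simp: asymptotically_stable_def in_rf_poles_iff roots)
  have coeff: "coeff P m = complex_of_real \<beta>"
    unfolding \<beta>_def
    by (rule coeff_transfer_function[OF A B C _ P_le Q]) (simp flip: realization DPQ)
  have "\<beta> \<noteq> 0" using coeff deg(1) \<open>P \<noteq> 0\<close> by (metis leading_coeff_0_iff of_real_0)
  have plus: "(\<forall>s. poly P s = 0 \<longrightarrow> Re s < 0) \<longleftrightarrow>
      (\<exists>g::real. strictly_positive_real (D / (1 + rf_const (complex_of_real g) * D)))" if "\<beta> > 0"
    by (rule hurwitz_iff_feedback_strictly_positive_real[OF real no_common_root deg(1) coeff that Q DPQ])
  have minus: "(\<forall>s. poly P s = 0 \<longrightarrow> Re s < 0) \<longleftrightarrow>
      (\<exists>g::real. strictly_positive_real (- D / (1 - rf_const (complex_of_real g) * D)))" if "\<beta> < 0"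
    using hurwitz_iff_feedback_strictly_positive_real[of "- P" Q m "- \<beta>" "- D"]
      real no_common_root deg(1) coeff that Q DPQ by simp
  have fb: "D / (1 + rf_const (complex_of_real g) * D) = transfer_function (A - g \<cdot>\<^sub>m (B * C)) B C" for g
    using transfer_function_feedback[OF A B C, of g] by (simp add: realization)
  have neg: "A - (- g) \<cdot>\<^sub>m (B * C) = A + g \<cdot>\<^sub>m (B * C)" for g
    using A B C by (intro eq_matI) auto
  have fb_neg: "- D / (1 - rf_const (complex_of_real g) * D)
      = - transfer_function (A + g \<cdot>\<^sub>m (B * C)) B C" for g
    using fb[of "- g"] by (simp add: neg)
  show ?thesis
    unfolding \<beta>_def[symmetric]
  proof (intro conjI allI)
    show "asymptotically_stable H \<longleftrightarrow>
        \<beta> > 0 \<and> (\<exists>g::real. strictly_positive_real (D / (1 + rf_const (complex_of_real g) * D))) \<or>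
        \<beta> < 0 \<and> (\<exists>g::real. strictly_positive_real (- D / (1 - rf_const (complex_of_real g) * D)))"
    proof (cases "\<beta> > 0")
      case True
      then show ?thesis unfolding stable plus[OF True] by simp
    next
      case False
      then have "\<beta> < 0" using \<open>\<beta> \<noteq> 0\<close> by simp
      then show ?thesis unfolding stable minus[OF \<open>\<beta> < 0\<close>] using False by simp
    qed
  next
    fix g :: real
    show "D / (1 + rf_const (complex_of_real g) * D) = transfer_function (A - g \<cdot>\<^sub>m (B * C)) B C"
      by (rule fb)
    show "- D / (1 - rf_const (complex_of_real g) * D) = - transfer_function (A + g \<cdot>\<^sub>m (B * C)) B C"
      by (rule fb_neg)
  qed
qed

end
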